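(* Let $q\ge 1$, $r\ge 1$, and let $n_1,\dots,n_r,m_1,\dots,m_r$ be nonnegative integers with $n_1,m_1\ge 1$ and $n_1\ge n_i$ for all $i$. Suppose that $$P= RL^{q}\,(RL^{q-1}R)^{n_1}(RL^{q})^{m_1}(RL^{q-1}R)^{n_2}(RL^{q})^{m_2}\cdots (RL^{q-1}R)^{n_r}(RL^{q})^{m_r}\,RL^{q-1}C$$ is an MSS-sequence. Then $P$ is non-primary, with $P=O_h*O_s$ and $O_h=RL^{q-1}C$ for some MSS-sequence $O_s$.
   Context: An admissible sequence is a finite word $A_1A_2\cdots A_p$ with $A_i\in\{R,L\}$ for $i<p$ and $A_p=C$. Put $L<C<R$. The parity-lexicographic order on admissible sequences: if $P^1\neq P^2$ and $i$ is the first index where they differ, then, if the common prefix of length $i-1$ contains an even number of $R$s, $P^1<P^2$ iff $A^1_i<A^2_i$; if it contains an odd number of $R$s, $P^1<P^2$ iff $A^2_i<A^1_i$. The right shifts of $P$ are $\sigma^k(P)=A_{k+1}\cdots A_p$; $P$ is shift maximal if it is greater than or equal to each of its right shifts. The MSS-sequences (for unimodal round-top concave maps) are exactly the shift maximal admissible sequences (results of Beyer, Mauldin and Stein); this is taken here as the meaning of "MSS-sequence". Composition (Derrida–Gervois–Pomeau): for $O_h=x_1\cdots x_{h-1}C$ and $O_s=y_1\cdots y_{s-1}C$ with $x_i,y_j\in\{R,L\}$, put $Q=x_1\cdots x_{h-1}$. If $O_h$ contains an even number of $R$s, $O_h*O_s=Qy_1Qy_2\cdots y_{s-1}QC$; if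 it contains an odd number of $R$s, $O_h*O_s=Q\overline{y_1}Q\overline{y_2}\cdots\overline{y_{s-1}}QC$, where $\overline R=L$, $\overline L=R$. An MSS-sequence is non-primary if it equals $O_h*O_s$ for some MSS-sequences $O_h,O_s$ of length at least $2$, and primary otherwise. *)

theory Defs
  imports Main
begin

datatype letter = L | C | R

instantiation letter :: linorder
begin

fun less_letter :: "letter \<Rightarrow> letter \<Rightarrow> bool" where
  "less_letter L C = True"
| "less_letter L R = True"
| "less_letter C R = True"
| "less_letter _ _ = False"

definition less_eq_letter :: "letter \<Rightarrow> letter \<Rightarrow> bool" where
  "less_eq_letter a b \<longleftrightarrow> a < b \<or> a = b"

instance
proof
  fix a b c :: letter
  show "(a < b) = (a \<le> b \<and> \<not> b \<le> a)"
    by (cases a; cases b) (simp_all add: less_eq_letter_def)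
  show "a \<le> a"
    by (simp add: less_eq_letter_def)
  show "a \<le> b \<Longrightarrow> b \<le> c \<Longrightarrow> a \<le> c"
    by (cases a; cases b; cases c) (simp_all add: less_eq_letter_def)
  show "a \<le> b \<Longrightarrow> b \<le> a \<Longrightarrow> a = b"
    by (cases a; cases b) (simp_all add: less_eq_letter_def)
  show "a \<le> b \<or> b \<le> a"
    by (cases a; cases b) (simp_all add: less_eq_letter_def)
qed

end

definition admissible :: "letter list \<Rightarrow> bool" where
  "admissible P \<longleftrightarrow> P \<noteq> [] \<and> set (butlast P) \<subseteq> {R, L} \<and> last P = C"

text \<open>The letter \<open>C\<close> occurs in an admissible sequence only at the end, so neither of two
  distinct admissible sequences is a prefix of the other, and bounding the index \<open>i\<close> of the
  first difference (counted from 0) by both lengths loses nothing.\<close>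

definition parity_lex_less :: "letter list \<Rightarrow> letter list \<Rightarrow> bool" where
  "parity_lex_less P1 P2 \<longleftrightarrow>
     (\<exists>i. i < length P1 \<and> i < length P2 \<and> take i P1 = take i P2 \<and> P1 ! i \<noteq> P2 ! i \<and>
        (if even (count_list (take i P1) R) then P1 ! i < P2 ! i else P2 ! i < P1 ! i))"

definition shift_maximal :: "letter list \<Rightarrow> bool" where
  "shift_maximal P \<longleftrightarrow> (\<forall>k < length P. drop k P = P \<or> parity_lex_less (drop k P) P)"

definition MSS :: "letter list \<Rightarrow> bool" where
  "MSS P \<longleftrightarrow> admissible P \<and> shift_maximal P"

text \<open>Only the values at \<open>R\<close> and \<open>L\<close> matter; \<open>C\<close> is fixed by convention.\<close>

fun flip :: "letter \<Rightarrow> letter" where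
  "flip R = L"
| "flip L = R"
| "flip C = C"

text \<open>For admissible arguments the final \<open>C\<close> of each is dropped by \<^const>\<open>butlast\<close>.\<close>

definition compose :: "letter list \<Rightarrow> letter list \<Rightarrow> letter list" (infixl "\<star>" 70) where
  "Oh \<star> Os =
     (let Q = butlast Oh;
          f = (if even (count_list Oh R) then (\<lambda>y. y) else flip)
      in concat (map (\<lambda>y. Q @ [f y]) (butlast Os)) @ Q @ [C])"

definition non_primary :: "letter list \<Rightarrow> bool" where
  "non_primary P \<longleftrightarrow> MSS P \<and>
     (\<exists>Oh Os. MSS Oh \<and> MSS Os \<and> length Oh \<ge> 2 \<and> length Os \<ge> 2 \<and> P = Oh \<star> Os)"

abbreviation word_power :: "letter list \<Rightarrow> nat \<Rightarrow> letter list" where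
  "word_power w n \<equiv> concat (replicate n w)"

end

theory Submission
  imports Defs
begin

text \<open>The blocks of \<open>P\<close> are \<open>RL\<^sup>q = QL\<close> and \<open>RL\<^sup>q\<^sup>-\<^sup>1R = QR\<close> with \<open>Q = RL\<^sup>q\<^sup>-\<^sup>1\<close>, so reading off the
  letter after each \<open>Q\<close> and flipping it (\<open>Q\<close> has one \<open>R\<close>) yields the factor \<open>O\<^sub>s\<close>. The map
  \<open>O\<^sub>s \<mapsto> O\<^sub>h \<star> O\<^sub>s\<close> is strictly monotone: if \<open>Q\<close> is odd, then each \<open>Q\<close> reverses the order and so
  does \<open>flip\<close>. Since it also turns the shift by \<open>k\<close> into the shift by
  \<open>k \<cdot> |O\<^sub>h|\<close>, totality of the order pulls shift maximality of \<open>P\<close> back to \<open>O\<^sub>s\<close>.\<close>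

lemma parity_lex_less_Nil [simp]: "\<not> parity_lex_less [] ys" "\<not> parity_lex_less xs []"
  by (simp_all add: parity_lex_less_def)

text \<open>Removing a common head moves the first difference down by one, and a head
  \<open>R\<close> toggles the parity of the prefix, which amounts to swapping the arguments. Parity
  counting thus becomes a structural recursion.\<close>

lemma parity_lex_less_Cons [simp]:
  "parity_lex_less (x # xs) (y # ys) \<longleftrightarrow>
     (if x = y then (if x = R then parity_lex_less ys xs else parity_lex_less xs ys) else x < y)"
  (is "?l \<longleftrightarrow> ?r")
proof (cases "x = y")
  case False
  show ?thesis
  proof
    assume ?l
    then obtain i where "take i (x # xs) = take i (y # ys)"
      "if even (count_list (take i (x # xs)) R) then (x # xs) ! i < (y # ys) ! i
       else (y # ys) ! i < (x # xs) ! i"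
      unfolding parity_lex_less_def by blast
    with False show ?r by (cases i) auto
  next
    assume ?r
    with False show ?l
      unfolding parity_lex_less_def by (intro exI[of _ 0]) auto
  qed
next
  case True
  have "?l \<longleftrightarrow> (\<exists>i. i < length xs \<and> i < length ys \<and> take i xs = take i ys \<and> xs ! i \<noteq> ys ! i \<and>
      (if even (count_list (x # take i xs) R) then xs ! i < ys ! i else ys ! i < xs ! i))"
    (is "_ \<longleftrightarrow> (\<exists>i. ?A i)")
  proof
    assume ?l
    then obtain j where j: "j < length (x # xs)" "j < length (y # ys)"
      "take j (x # xs) = take j (y # ys)" "(x # xs) ! j \<noteq> (y # ys) ! j"
      "if even (count_list (take j (x # xs)) R) then (x # xs) ! j < (y # ys) ! j
       else (y # ys) ! j < (x # xs) ! j"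
      unfolding parity_lex_less_def by blast
    with True obtain i where "j = Suc i" by (cases j) auto
    from j[unfolded this] True show "\<exists>i. ?A i"
      by (intro exI[of _ i]) (auto split: if_splits)
  next
    assume "\<exists>i. ?A i"
    then obtain i where "?A i" ..
    with True show ?l
      unfolding parity_lex_less_def by (intro exI[of _ "Suc i"]) simp
  qed
  also have "\<dots> \<longleftrightarrow> ?r"
  proof (cases "x = R")
    case True
    \<comment> \<open>The extra \<open>R\<close> inverts the parity test; since the prefixes agree,
      the result is the defining condition with the two words exchanged.\<close>
    have "?A i \<longleftrightarrow> i < length ys \<and> i < length xs \<and> take i ys = take i xs \<and> ys ! i \<noteq> xs ! i \<and>
        (if even (count_list (take i ys) R) then ys ! i < xs ! i else xs ! i < ys ! i)" for i
      unfolding True by simp metis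
    with True \<open>x = y\<close> show ?thesis
      by (simp only: parity_lex_less_def if_True refl)
  next
    case False
    with \<open>x = y\<close> show ?thesis
      by (simp add: parity_lex_less_def)
  qed
  finally show ?thesis .
qed

lemma parity_lex_less_append:
  "parity_lex_less (zs @ xs) (zs @ ys) \<longleftrightarrow>
     (if even (count_list zs R) then parity_lex_less xs ys else parity_lex_less ys xs)"
  by (induction zs arbitrary: xs ys) auto

lemma parity_lex_less_asym: "parity_lex_less xs ys \<Longrightarrow> \<not> parity_lex_less ys xs"
  by (induction xs arbitrary: ys) (case_tac ys; auto split: if_splits)+

lemma admissible_Nil [simp]: "\<not> admissible []"
  by (simp add: admissible_def)

lemma admissible_Cons:
  "admissible (x # xs) \<longleftrightarrow> (if xs = [] then x = C else x \<noteq> C \<and> admissible xs)"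
  by (cases x) (auto simp: admissible_def)

lemma admissible_drop: "admissible xs \<Longrightarrow> k < length xs \<Longrightarrow> admissible (drop k xs)"
  by (induction xs arbitrary: k) (case_tac k; auto simp: admissible_Cons split: if_splits)+

lemma parity_lex_less_total:
  assumes "admissible xs" "admissible ys" "xs \<noteq> ys"
  shows "parity_lex_less xs ys \<or> parity_lex_less ys xs"
  using assms
proof (induction xs arbitrary: ys)
  case (Cons x xs)
  then obtain y ys' where "ys = y # ys'" by (cases ys) auto
  with Cons show ?case
    by (cases x; cases y) (auto simp: admissible_Cons split: if_splits)
qed simp

lemma compose_single [simp]: "Oh \<star> [y] = butlast Oh @ [C]"
  by (simp add: compose_def)

lemma compose_Cons:
  "ys \<noteq> [] \<Longrightarrow>
   Oh \<star> (y # ys) = butlast Oh @ (if even (count_list Oh R) then y else flip y) # Oh \<star> ys"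
  by (simp add: compose_def Let_def)

text \<open>Each letter of \<open>Os\<close>, the final one included, accounts for one block of the
  length of \<open>Oh\<close>: a copy of \<open>butlast Oh\<close> and one more letter.\<close>

lemma length_compose:
  "Oh \<noteq> [] \<Longrightarrow> Os \<noteq> [] \<Longrightarrow> length (Oh \<star> Os) = length Oh * length Os"
proof (induction Os)
  case (Cons y ys)
  then show ?case by (cases "ys = []") (auto simp: compose_Cons)
qed simp

lemma drop_compose:
  assumes "Oh \<noteq> []" "k < length Os"
  shows "drop (k * length Oh) (Oh \<star> Os) = Oh \<star> drop k Os"
  using assms
proof (induction k arbitrary: Os)
  case (Suc k)
  from Suc.prems obtain y ys where "Os = y # ys" "k < length ys"
    by (cases Os) auto
  moreover from this have "ys \<noteq> []" by auto
  moreover have "drop (length Oh) (Oh \<star> (y # ys)) = Oh \<star> ys"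
    using \<open>ys \<noteq> []\<close> Suc.prems by (cases "length Oh") (auto simp: compose_Cons)
  moreover have "drop (Suc k * length Oh) (Oh \<star> Os) =
      drop (k * length Oh) (drop (length Oh) (Oh \<star> Os))"
    by (simp add: add.commute)
  ultimately show ?case
    using Suc.IH Suc.prems(1) by simp
qed simp

lemma flip_inject: "flip x = flip y \<longleftrightarrow> x = y"
  by (cases x; cases y) auto

lemma flip_less: "flip x < flip y \<longleftrightarrow> y < x"
  by (cases x; cases y) auto

lemma parity_lex_less_compose:
  assumes "admissible Oh" "admissible xs" "admissible ys"
  shows "parity_lex_less (Oh \<star> xs) (Oh \<star> ys) \<longleftrightarrow> parity_lex_less xs ys"
proof -
  have "Oh = butlast Oh @ [C]"
    using \<open>admissible Oh\<close> append_butlast_last_id by (fastforce simp: admissible_def)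
  then have parity: "count_list (butlast Oh) R = count_list Oh R"
    by (metis append_Nil2 count_list.simps count_list_append letter.distinct(5) add.right_neutral)
  let ?f = "\<lambda>y. if even (count_list Oh R) then y else flip y"
  \<comment> \<open>The final block has the same shape, as \<open>flip C = C\<close>; there
    \<open>zs\<close> is empty.\<close>
  have expand: "\<exists>zs. Oh \<star> (y # ys) = butlast Oh @ ?f y # zs \<and> (ys \<noteq> [] \<longrightarrow> zs = Oh \<star> ys)"
    if "admissible (y # ys)" for y ys
    using that by (cases "ys = []") (auto simp: compose_Cons admissible_Cons)
  \<comment> \<open>Both directions are proved together because a common head \<open>R\<close> swaps
    the arguments while the induction runs over \<open>xs\<close> only.\<close>
  have "(parity_lex_less (Oh \<star> xs) (Oh \<star> ys) \<longleftrightarrow> parity_lex_less xs ys) \<and>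
        (parity_lex_less (Oh \<star> ys) (Oh \<star> xs) \<longleftrightarrow> parity_lex_less ys xs)"
    using assms(2,3)
  proof (induction xs arbitrary: ys)
    case (Cons x xs)
    then obtain y ys' where ys: "ys = y # ys'" by (cases ys) auto
    obtain us where us: "Oh \<star> (x # xs) = butlast Oh @ ?f x # us" "xs \<noteq> [] \<longrightarrow> us = Oh \<star> xs"
      using expand Cons.prems(1) by blast
    obtain vs where vs: "Oh \<star> ys = butlast Oh @ ?f y # vs" "ys' \<noteq> [] \<longrightarrow> vs = Oh \<star> ys'"
      using expand Cons.prems(2) ys by blast
    show ?case
    proof (cases "x = y")
      case False
      then show ?thesis
        by (simp add: us vs[unfolded ys] ys parity_lex_less_append parity flip_inject flip_less)
    next
      case True
      show ?thesis
      proof (cases "x = C")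
        \<comment> \<open>A common \<open>C\<close> ends both words, so they coincide and asymmetry
          makes every comparison false.\<close>
        case True
        with \<open>x = y\<close> Cons.prems ys have "x # xs = ys"
          by (auto simp: admissible_Cons split: if_splits)
        then show ?thesis using parity_lex_less_asym by blast
      next
        case False
        with Cons.prems ys \<open>x = y\<close> have adm: "admissible xs" "admissible ys'" "xs \<noteq> []" "ys' \<noteq> []"
          by (auto simp: admissible_Cons split: if_splits)
        note IH = Cons.IH[OF adm(1,2)]
        \<comment> \<open>The order is swapped by the block \<open>butlast Oh @ [?f x]\<close>
          exactly when it is swapped by \<open>x\<close>: for odd \<open>Oh\<close>, flipping
          \<open>x\<close> compensates the odd number of \<open>R\<close> in
          \<open>butlast Oh\<close>.\<close>
        from False have "x = R \<or> x = L" by (cases x) auto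
        with IH adm us(2) vs(2) show ?thesis
          unfolding us(1) vs(1)[unfolded ys] ys parity_lex_less_append parity
          by (auto simp: \<open>x = y\<close>[symmetric])
      qed
    qed
  qed simp
  then show ?thesis ..
qed

lemma shift_maximal_right_factor:
  assumes "admissible Oh" "admissible Os" "shift_maximal (Oh \<star> Os)"
  shows "shift_maximal Os"
  unfolding shift_maximal_def
proof (intro allI impI)
  fix k assume k: "k < length Os"
  have "Oh \<noteq> []" "Os \<noteq> []" using assms by auto
  then have "k * length Oh < length (Oh \<star> Os)"
    using k by (simp add: length_compose)
  with assms(3) have "Oh \<star> drop k Os = Oh \<star> Os \<or> parity_lex_less (Oh \<star> drop k Os) (Oh \<star> Os)"
    unfolding shift_maximal_def using drop_compose[OF \<open>Oh \<noteq> []\<close> k] by metis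
  \<comment> \<open>Equality and strict inequality both exclude the reverse comparison. This negated
    form transfers to \<open>Os\<close>, where totality turns it back into the disjunction.\<close>
  then have "\<not> parity_lex_less (Oh \<star> Os) (Oh \<star> drop k Os)"
    using parity_lex_less_asym by metis
  then have "\<not> parity_lex_less Os (drop k Os)"
    using assms k by (simp add: parity_lex_less_compose admissible_drop)
  then show "drop k Os = Os \<or> parity_lex_less (drop k Os) Os"
    using parity_lex_less_total assms(2) admissible_drop k by blast
qed

lemma MSS_R_power_L: "MSS (R # replicate k L @ [C])"
proof -
  \<comment> \<open>Every proper shift starts with \<open>L\<close> or, when j = k, with
    \<open>C\<close>; both lie below \<open>R\<close>, so the first letter decides.\<close>
  have "parity_lex_less (drop j (replicate k L @ [C])) (R # ys)" if "j \<le> k" for j ys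
    using that by (cases "k - j") auto
  then have "shift_maximal (R # replicate k L @ [C])"
    unfolding shift_maximal_def by (auto simp: drop_Cons' simp del: drop_append)
  then show ?thesis
    by (auto simp: MSS_def admissible_def butlast_append)
qed

theorem theorem9:
  fixes q r :: nat and n m :: "nat \<Rightarrow> nat" and P Oh :: "letter list"
  assumes "q \<ge> 1" and "r \<ge> 1"
    and "n 1 \<ge> 1" and "m 1 \<ge> 1"
    and "\<forall>i\<in>{1..r}. n i \<le> n 1"
    and "P = [R] @ replicate q L
           @ concat (map (\<lambda>i. word_power ([R] @ replicate (q - 1) L @ [R]) (n i)
                            @ word_power ([R] @ replicate q L) (m i)) [1..<r + 1])
           @ [R] @ replicate (q - 1) L @ [C]"
    and "Oh = [R] @ replicate (q - 1) L @ [C]"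
    and "MSS P"
  shows "non_primary P \<and>
         MSS Oh \<and> length Oh \<ge> 2 \<and> (\<exists>Os. MSS Os \<and> length Os \<ge> 2 \<and> P = Oh \<star> Os)"
proof -
  \<comment> \<open>Because of the flip, \<open>L\<close> encodes the block
    \<open>butlast Oh @ [R]\<close> and \<open>R\<close> encodes \<open>butlast Oh @ [L]\<close>. In
    \<open>Os\<close>, the leading \<open>R\<close> stands for the initial block of \<open>P\<close>
    and the final \<open>C\<close> for its tail.\<close>
  define w where "w = concat (map (\<lambda>i. replicate (n i) L @ replicate (m i) R) [1..<r + 1])"
  define Os where "Os = R # w @ [C]"
  let ?g = "\<lambda>y. butlast Oh @ [flip y]"
  have Oh: "MSS Oh" "length Oh \<ge> 2"
    using MSS_R_power_L[of "q - 1"] assms(7) by auto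
  have Q: "butlast Oh = R # replicate (q - 1) L"
    using assms(7) by (simp add: butlast_append)
  have "count_list (replicate k L) R = 0" for k
    by (induction k) auto
  then have odd: "odd (count_list Oh R)"
    using assms(7) by simp
  have gL: "?g L = [R] @ replicate (q - 1) L @ [R]"
    using Q by simp
  have gR: "?g R = [R] @ replicate q L"
    \<comment> \<open>Truncated subtraction: q - 1 letters \<open>L\<close> and one more make q only
      for positive q.\<close>
    using Q \<open>q \<ge> 1\<close> by (cases q) (simp_all add: replicate_append_same)
  have blocks: "concat (map ?g (concat (map (\<lambda>i. replicate (n i) L @ replicate (m i) R) js))) =
      concat (map (\<lambda>i. word_power ([R] @ replicate (q - 1) L @ [R]) (n i)
                     @ word_power ([R] @ replicate q L) (m i)) js)" for js
    \<comment> \<open>Once the blocks are written as images of single letters, only the interplay of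
      \<open>concat\<close>, \<open>map\<close> and \<open>replicate\<close> remains.\<close>
    unfolding gL[symmetric] gR[symmetric] by (induction js) simp_all
  have "Oh \<star> Os = ?g R @ concat (map ?g w) @ butlast Oh @ [C]"
    using odd by (simp add: compose_def Let_def Os_def butlast_append)
  also have "\<dots> = P"
    unfolding w_def blocks gR unfolding Q assms(6) by simp
  finally have P: "P = Oh \<star> Os" ..
  have "set w \<subseteq> {R, L}"
    unfolding w_def by auto
  then have "admissible Os"
    unfolding Os_def admissible_def by (simp add: butlast_append)
  then have "MSS Os"
    using shift_maximal_right_factor Oh(1) \<open>MSS P\<close> P by (auto simp: MSS_def)
  moreover have "length Os \<ge> 2"
    by (simp add: Os_def)
  ultimately show ?thesis
    using Oh P \<open>MSS P\<close> unfolding non_primary_def by blast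
qed

end
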